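(* Every monotone Borel function $f \colon 2^{\mathbb{N}} \to \{0,1\}$ is computed by a monotone circuit.
   Context: $2^{\mathbb{N}}$ is the Cantor space of infinite binary strings $x = x_0x_1\cdots$. A function $f \colon 2^{\mathbb{N}} \to \{0,1\}$ is Borel if $f^{-1}(\{1\})$ is Borel. Write $x \leq y$ if $x_i \leq y_i$ for every $i \in \mathbb{N}$; $f$ is monotone if $f(x) \leq f(y)$ whenever $x \leq y$. A circuit $C$ is a countable, well-founded (no infinite branch) rooted tree whose nodes (gates) are labeled: every node with at least one child (internal gate) is labeled $\wedge$ or $\vee$; every leaf (input gate) is labeled $0$, $1$, $x_i$, or $\overline{x}_i$ for some $i \in \mathbb{N}$. On input $x \in 2^{\mathbb{N}}$, gates are evaluated inductively: a leaf evaluates to its label ($x_i$ is the $i$-th bit of $x$, $\overline{x}_i$ its negation), an $\wedge$-gate to the conjunction of the evaluations of its children, and an $\vee$-gate to the disjunction of the evaluations of its children. $C(x)$ is the evaluation of the root, and $C$ computes the function $x \mapsto C(x)$. A circuit is monotone if no leaf is labeled by a negated literal $\overline{x}_i$. *)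

theory Defs
  imports "HOL-Analysis.Analysis"
begin

text \<open>
  The Cantor space is the type \<^typ>\<open>nat \<Rightarrow> bool\<close> with the library's product topology (the
  topology on \<^typ>\<open>bool\<close> is discrete), and \<^const>\<open>mono\<close> at type
  \<^typ>\<open>(nat \<Rightarrow> bool) \<Rightarrow> bool\<close> refers to the pointwise order, with
  \<^term>\<open>False\<close> below \<^term>\<open>True\<close>.
\<close>

definition borel_function :: "((nat \<Rightarrow> bool) \<Rightarrow> bool) \<Rightarrow> bool" where
  "borel_function f \<longleftrightarrow> f -` {True} \<in> sets borel"

datatype gate_label = And | Or | Const bool | Pos nat | Neg nat

text \<open>
  A countable rooted tree is given, up to isomorphism, by a prefix-closed set of finite sequences
  of natural numbers: the root is the empty sequence, and the children of \<^term>\<open>g\<close> are the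
  sequences in the set that extend \<^term>\<open>g\<close> by one entry. The values of the labelling outside
  the tree are irrelevant.
\<close>

record circuit =
  gates :: "nat list set"
  label :: "nat list \<Rightarrow> gate_label"

definition children :: "circuit \<Rightarrow> nat list \<Rightarrow> nat list set" where
  "children C g = {h \<in> gates C. \<exists>n. h = g @ [n]}"

definition rooted_tree :: "circuit \<Rightarrow> bool" where
  "rooted_tree C \<longleftrightarrow>
     [] \<in> gates C \<and> (\<forall>g n. g @ [n] \<in> gates C \<longrightarrow> g \<in> gates C)"

definition no_infinite_branch :: "circuit \<Rightarrow> bool" where
  "no_infinite_branch C \<longleftrightarrow> (\<nexists>b. \<forall>n. b (Suc n) \<in> children C (b n))"

definition is_circuit :: "circuit \<Rightarrow> bool" where
  "is_circuit C \<longleftrightarrow> rooted_tree C \<and> no_infinite_branch C \<and>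
     (\<forall>g\<in>gates C. label C g \<in> {And, Or} \<longleftrightarrow> children C g \<noteq> {})"

definition monotone_circuit :: "circuit \<Rightarrow> bool" where
  "monotone_circuit C \<longleftrightarrow> is_circuit C \<and> (\<forall>g\<in>gates C. \<forall>i. label C g \<noteq> Neg i)"

text \<open>
  The guard only serves to make the recursion terminate; it holds for every circuit.
\<close>

function eval_gate :: "circuit \<Rightarrow> (nat \<Rightarrow> bool) \<Rightarrow> nat list \<Rightarrow> bool" where
  "eval_gate C x g =
     (if no_infinite_branch C then
        (case label C g of
           And \<Rightarrow> (\<forall>h\<in>children C g. eval_gate C x h)
         | Or \<Rightarrow> (\<exists>h\<in>children C g. eval_gate C x h)
         | Const b \<Rightarrow> b
         | Pos i \<Rightarrow> x i
         | Neg i \<Rightarrow> \<not> x i)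
      else undefined)"
  by pat_completeness auto
termination
proof -
  define R where
    "R = {((D, y, h), (C, x :: nat \<Rightarrow> bool, g)).
            D = C \<and> y = x \<and> no_infinite_branch C \<and> h \<in> children C g}"
  have "wf R"
    unfolding wf_iff_no_infinite_down_chain
  proof
    assume "\<exists>s. \<forall>n. (s (Suc n), s n) \<in> R"
    then obtain s where s: "(s (Suc n), s n) \<in> R" for n by blast
    define b where "b n = snd (snd (s n))" for n
    have step: "fst (s (Suc n)) = fst (s n) \<and> no_infinite_branch (fst (s n)) \<and>
        b (Suc n) \<in> children (fst (s n)) (b n)" for n
      using s[of n] by (auto simp: R_def b_def split: prod.splits)
    have "fst (s n) = fst (s 0)" for n
      by (induction n) (use step in auto)
    then show False
      using step unfolding no_infinite_branch_def by metis
  qed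
  then show ?thesis
    by (relation R) (auto simp: R_def)
qed

declare eval_gate.simps [simp del]

definition eval_circuit :: "circuit \<Rightarrow> (nat \<Rightarrow> bool) \<Rightarrow> bool" where
  "eval_circuit C x = eval_gate C x []"

definition computes :: "circuit \<Rightarrow> ((nat \<Rightarrow> bool) \<Rightarrow> bool) \<Rightarrow> bool" where
  "computes C f \<longleftrightarrow> (\<forall>x. eval_circuit C x = f x)"

end

theory Submission
  imports Defs
begin

text \<open>
  The proof is Lusin's separation theorem for analytic sets, with the Borel sets replaced by the
  sets that monotone circuits compute. As \<^term>\<open>f\<close> is Borel, the set where it is true and the
  set where it is false are both analytic, that is, projections of closed sets \<open>K\<close> and \<open>L\<close> of
  pairs (point, witness), where a witness is a sequence of natural numbers
  (\<open>borel_imp_analytic_and_coanalytic\<close>). A function that separates the two projections is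
  \<^term>\<open>f\<close> itself, so it suffices to separate them by a monotone circuit.

  Suppose that this is impossible. Cut \<open>K\<close> and \<open>L\<close> into countably many pieces according to the
  first entry of the point and of the witness. If every piece of \<open>K\<close> could be separated from every
  piece of \<open>L\<close>, then a countable disjunction of countable conjunctions of the separating circuits
  would separate \<open>K\<close> from \<open>L\<close>, and this circuit is again monotone (\<open>circuit_separable_fibres\<close>).
  Hence some two pieces are inseparable. Repeating this for the second entries, the third ones and
  so on fixes in the limit one pair \<open>(a, \<alpha>)\<close> and one pair \<open>(b, \<beta>)\<close>, which lie in \<open>K\<close>
  and \<open>L\<close> because these sets are closed. So \<open>f a\<close> is true and \<open>f b\<close> is false. Monotonicity of
  \<^term>\<open>f\<close> excludes \<open>a \<le> b\<close>, so \<open>a\<^sub>i = 1\<close> and \<open>b\<^sub>i = 0\<close> for some \<open>i\<close>. But once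
  entry \<open>i\<close> has been fixed, the single input gate \<open>x\<^sub>i\<close> separates the two pieces, a
  contradiction (\<open>circuit_separable_closed\<close>).
\<close>

section \<open>Monotone circuits compose\<close>

definition monotone_computable :: "((nat \<Rightarrow> bool) \<Rightarrow> bool) \<Rightarrow> bool" where
  "monotone_computable f \<longleftrightarrow> (\<exists>C. monotone_circuit C \<and> computes C f)"

definition leaf :: "gate_label \<Rightarrow> circuit" where
  "leaf l = \<lparr>gates = {[]}, label = (\<lambda>_. l)\<rparr>"

lemma no_infinite_branch_leaf: "no_infinite_branch (leaf l)"
  by (auto simp: no_infinite_branch_def children_def leaf_def)

lemma eval_leaf:
  "eval_circuit (leaf (Const b)) x = b" "eval_circuit (leaf (Pos i)) x = x i"
  unfolding eval_circuit_def
  by (subst eval_gate.simps, simp add: no_infinite_branch_leaf, simp add: leaf_def)+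

lemma monotone_leaf:
  assumes "l \<notin> {And, Or}" "\<And>i. l \<noteq> Neg i"
  shows "monotone_circuit (leaf l)"
  using assms no_infinite_branch_leaf[of l]
  by (auto simp: monotone_circuit_def is_circuit_def rooted_tree_def leaf_def children_def)

lemma monotone_computable_const: "monotone_computable (\<lambda>x. b)"
  unfolding monotone_computable_def computes_def
  by (rule exI[of _ "leaf (Const b)"]) (simp add: eval_leaf monotone_leaf)

lemma monotone_computable_coordinate: "monotone_computable (\<lambda>x. x i)"
  unfolding monotone_computable_def computes_def
  by (rule exI[of _ "leaf (Pos i)"]) (simp add: eval_leaf monotone_leaf)

text \<open>The circuits \<open>C 0, C 1, \<dots>\<close> become the subtrees of a new root with label \<open>l\<close>.\<close>

definition join :: "gate_label \<Rightarrow> (nat \<Rightarrow> circuit) \<Rightarrow> circuit" where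
  "join l C = \<lparr>gates = insert [] {n # g |n g. g \<in> gates (C n)},
     label = (\<lambda>g. case g of [] \<Rightarrow> l | n # g \<Rightarrow> label (C n) g)\<rparr>"

lemma label_join [simp]: "label (join l C) [] = l" "label (join l C) (n # g) = label (C n) g"
  by (simp_all add: join_def)

lemma children_join_Cons: "children (join l C) (n # g) = (#) n ` children (C n) g"
  by (auto simp: children_def join_def)

lemma children_join_Nil:
  assumes "\<And>n. rooted_tree (C n)"
  shows "children (join l C) [] = range (\<lambda>n. [n])"
  using assms by (auto simp: children_def join_def rooted_tree_def)

lemma no_infinite_branch_join:
  assumes "\<And>n. no_infinite_branch (C n)"
  shows "no_infinite_branch (join l C)"
  unfolding no_infinite_branch_def
proof
  assume "\<exists>b. \<forall>k. b (Suc k) \<in> children (join l C) (b k)"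
  then obtain b where b: "b (Suc k) \<in> children (join l C) (b k)" for k
    by blast
  have "b 1 \<noteq> []"
    using b[of 0] by (auto simp: children_def)
  then obtain n g where "b 1 = n # g"
    by (auto simp: neq_Nil_conv)
  \<comment> \<open>After its first step the branch stays inside the \<open>n\<close>-th subtree.\<close>
  have "\<exists>g. b (Suc k) = n # g" for k
  proof (induction k)
    case 0
    then show ?case using \<open>b 1 = n # g\<close> by simp
  next
    case (Suc k)
    then show ?case using b[of "Suc k"] by (auto simp: children_def)
  qed
  then obtain c where c: "b (Suc k) = n # c k" for k
    by metis
  have "c (Suc k) \<in> children (C n) (c k)" for k
    using b[of "Suc k"] unfolding c children_join_Cons by auto
  then show False
    using assms unfolding no_infinite_branch_def by blast
qed

lemma eval_join_Cons:
  assumes "\<And>n. no_infinite_branch (C n)"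
  shows "eval_gate (join l C) x (n # g) = eval_gate (C n) x g"
proof -
  have "eval_gate (join l C) x (n # g) = eval_gate D x g" if "D = C n" for D
    \<comment> \<open>The circuit has to be a variable for the computation induction.\<close>
    using that
  proof (induction D x g rule: eval_gate.induct)
    case (1 D x g)
    have "no_infinite_branch D"
      using 1 assms by simp
    then show ?case
      using 1 by (subst (1 2) eval_gate.simps)
        (auto simp: no_infinite_branch_join[OF assms] children_join_Cons split: gate_label.split)
  qed
  then show ?thesis by simp
qed

lemma monotone_join:
  assumes "\<And>n. monotone_circuit (C n)" "l \<in> {And, Or}"
  shows "monotone_circuit (join l C)"
proof -
  have tree: "rooted_tree (C n)" and nib: "no_infinite_branch (C n)"
    and lab: "\<forall>g\<in>gates (C n). label (C n) g \<in> {And, Or} \<longleftrightarrow> children (C n) g \<noteq> {}"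
    and pos: "\<forall>g\<in>gates (C n). \<forall>i. label (C n) g \<noteq> Neg i" for n
    using assms(1)[of n] by (auto simp: monotone_circuit_def is_circuit_def)
  have gates: "gates (join l C) = insert [] {n # g |n g. g \<in> gates (C n)}"
    by (simp add: join_def)
  have "rooted_tree (join l C)"
    unfolding rooted_tree_def gates
  proof (intro conjI allI impI)
    fix g n
    assume "g @ [n] \<in> insert [] {n # g |n g. g \<in> gates (C n)}"
    then show "g \<in> insert [] {n # g |n g. g \<in> gates (C n)}"
      using tree by (cases g) (auto simp: rooted_tree_def)
  qed simp
  moreover have "label (join l C) g \<in> {And, Or} \<longleftrightarrow> children (join l C) g \<noteq> {}"
    if "g \<in> gates (join l C)" for g
    using that lab assms(2) children_join_Nil[OF tree, of l]
    unfolding gates by (cases g) (auto simp: children_join_Cons)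
  moreover have "label (join l C) g \<noteq> Neg i" if "g \<in> gates (join l C)" for g i
    using that pos assms(2) unfolding gates by (cases g) auto
  ultimately show ?thesis
    using no_infinite_branch_join[OF nib]
    by (auto simp: monotone_circuit_def is_circuit_def)
qed

lemma eval_join:
  assumes "\<And>n. is_circuit (C n)"
  shows "eval_circuit (join And C) x = (\<forall>n. eval_circuit (C n) x)"
    and "eval_circuit (join Or C) x = (\<exists>n. eval_circuit (C n) x)"
proof -
  have tree: "rooted_tree (C n)" and nib: "no_infinite_branch (C n)" for n
    using assms[of n] by (auto simp: is_circuit_def)
  show "eval_circuit (join And C) x = (\<forall>n. eval_circuit (C n) x)"
    unfolding eval_circuit_def
    by (subst eval_gate.simps)
      (simp add: no_infinite_branch_join[OF nib] children_join_Nil[OF tree] eval_join_Cons[OF nib])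
  show "eval_circuit (join Or C) x = (\<exists>n. eval_circuit (C n) x)"
    unfolding eval_circuit_def
    by (subst eval_gate.simps)
      (simp add: no_infinite_branch_join[OF nib] children_join_Nil[OF tree] eval_join_Cons[OF nib])
qed

lemma
  fixes f :: "nat \<Rightarrow> (nat \<Rightarrow> bool) \<Rightarrow> bool"
  assumes "\<And>n. monotone_computable (f n)"
  shows monotone_computable_all: "monotone_computable (\<lambda>x. \<forall>n. f n x)"
    and monotone_computable_ex: "monotone_computable (\<lambda>x. \<exists>n. f n x)"
proof -
  obtain C where C: "monotone_circuit (C n)" "computes (C n) (f n)" for n
    using assms unfolding monotone_computable_def by metis
  then have "is_circuit (C n)" for n
    by (simp add: monotone_circuit_def)
  note ev = eval_join[OF this]
  show "monotone_computable (\<lambda>x. \<forall>n. f n x)"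
    unfolding monotone_computable_def computes_def
    by (rule exI[of _ "join And C"]) (use C in \<open>simp add: ev monotone_join computes_def\<close>)
  show "monotone_computable (\<lambda>x. \<exists>n. f n x)"
    unfolding monotone_computable_def computes_def
    by (rule exI[of _ "join Or C"]) (use C in \<open>simp add: ev monotone_join computes_def\<close>)
qed

section \<open>Borel sets as projections of closed sets\<close>

text \<open>
  The second component is a witness for membership. Sequences of natural numbers can encode the
  index chosen in a countable union as well as the countably many witnesses for a countable
  intersection, which makes this class closed under both operations.
\<close>

definition analytic :: "(nat \<Rightarrow> bool) set \<Rightarrow> bool" where
  "analytic A \<longleftrightarrow> (\<exists>K :: ((nat \<Rightarrow> bool) \<times> (nat \<Rightarrow> nat)) set. closed K \<and> A = fst ` K)"

lemma analytic_closed: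
  assumes "closed A"
  shows "analytic A"
  unfolding analytic_def
  by (rule exI[of _ "A \<times> UNIV"]) (auto intro: closed_Times assms)

lemma closed_reindex:
  fixes K :: "((nat \<Rightarrow> bool) \<times> (nat \<Rightarrow> nat)) set" and r :: "nat \<Rightarrow> nat"
  assumes "closed K"
  shows "closed {p. (fst p, \<lambda>k. snd p (r k)) \<in> K}"
proof -
  have "continuous_on UNIV (\<lambda>p :: (nat \<Rightarrow> bool) \<times> (nat \<Rightarrow> nat). snd p (r k))" for k
    by (rule continuous_on_compose2[OF continuous_on_product_coordinates[of "r k"] continuous_on_snd])
       auto
  then have "continuous_on UNIV (\<lambda>p :: (nat \<Rightarrow> bool) \<times> (nat \<Rightarrow> nat). (fst p, \<lambda>k. snd p (r k)))"
    by (intro continuous_on_Pair continuous_on_coordinatewise_then_product continuous_on_fst) auto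
  from closed_vimage[OF assms this] show ?thesis
    by (simp add: vimage_def)
qed

text \<open>
  A witness for the union starts with an index \<open>n\<close> and continues with a witness for \<open>A n\<close>.
  The set of such pairs is closed since it is an intersection over all \<open>n\<close>, with one condition that
  is void unless the witness starts with \<open>n\<close>.
\<close>

lemma analytic_UN:
  fixes A :: "nat \<Rightarrow> (nat \<Rightarrow> bool) set"
  assumes "\<And>n. analytic (A n)"
  shows "analytic (\<Union>n. A n)"
proof -
  obtain K :: "nat \<Rightarrow> ((nat \<Rightarrow> bool) \<times> (nat \<Rightarrow> nat)) set"
    where K: "closed (K n)" "A n = fst ` K n" for n
    using assms unfolding analytic_def by metis
  let ?L = "\<Inter>n. {p. snd p 0 \<noteq> n} \<union> {p. (fst p, \<lambda>k. snd p (Suc k)) \<in> K n}"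
  have "closed {p :: (nat \<Rightarrow> bool) \<times> (nat \<Rightarrow> nat). snd p 0 \<noteq> n}" for n
  proof -
    have "continuous_on UNIV (\<lambda>p :: (nat \<Rightarrow> bool) \<times> (nat \<Rightarrow> nat). snd p 0)"
      by (rule continuous_on_compose2[OF continuous_on_product_coordinates[of 0] continuous_on_snd])
         auto
    from closed_vimage[OF _ this, of "- {n}"] show ?thesis
      by (simp add: vimage_def closed_def open_discrete)
  qed
  then have "closed ?L"
    by (intro closed_INT ballI closed_Un closed_reindex K(1))
  moreover have "(\<Union>n. A n) = fst ` ?L"
  proof (intro equalityI subsetI)
    fix x assume "x \<in> (\<Union>n. A n)"
    then obtain n a where "(x, a) \<in> K n"
      unfolding K(2) by auto
    then have "(x, case_nat n a) \<in> ?L" by simp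
    then show "x \<in> fst ` ?L" by (rule image_eqI[rotated]) simp
  next
    fix x assume "x \<in> fst ` ?L"
    then obtain a where "(x, a) \<in> ?L" by auto
    then have "(x, \<lambda>k. a (Suc k)) \<in> K (a 0)" by simp
    then show "x \<in> (\<Union>n. A n)"
      unfolding K(2) by (metis UN_I UNIV_I fst_conv imageI)
  qed
  ultimately show ?thesis
    unfolding analytic_def by blast
qed

text \<open>
  A witness for the intersection interleaves witnesses for all \<open>A n\<close> by the pairing function.
\<close>

lemma analytic_INT:
  fixes A :: "nat \<Rightarrow> (nat \<Rightarrow> bool) set"
  assumes "\<And>n. analytic (A n)"
  shows "analytic (\<Inter>n. A n)"
proof -
  obtain K :: "nat \<Rightarrow> ((nat \<Rightarrow> bool) \<times> (nat \<Rightarrow> nat)) set"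
    where K: "closed (K n)" "A n = fst ` K n" for n
    using assms unfolding analytic_def by metis
  let ?L = "\<Inter>n. {p. (fst p, \<lambda>k. snd p (prod_encode (n, k))) \<in> K n}"
  have "closed ?L"
    by (intro closed_INT ballI closed_reindex K(1))
  moreover have "(\<Inter>n. A n) = fst ` ?L"
  proof (intro equalityI subsetI)
    fix x assume "x \<in> (\<Inter>n. A n)"
    then have "\<forall>n. \<exists>a. (x, a) \<in> K n"
      unfolding K(2) by force
    then obtain a where "(x, a n) \<in> K n" for n by metis
    then have "(x, \<lambda>j. case prod_decode j of (n, k) \<Rightarrow> a n k) \<in> ?L" by simp
    then show "x \<in> fst ` ?L" by (rule image_eqI[rotated]) simp
  next
    fix x assume "x \<in> fst ` ?L"
    then show "x \<in> (\<Inter>n. A n)"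
      unfolding K(2) by force
  qed
  ultimately show ?thesis
    unfolding analytic_def by blast
qed

text \<open>
  This makes the Borel sets of the Cantor space agree with its product \<open>\<sigma>\<close>-algebra, which
  is generated by conditions on single coordinates.
\<close>

instance bool :: second_countable_topology
proof
  show "\<exists>B :: bool set set. countable B \<and> open = generate_topology B"
    by (rule exI[of _ UNIV])
      (auto simp: fun_eq_iff open_discrete countable_finite intro: generate_topology.Basis)
qed

text \<open>
  Analytic sets are not closed under complement, so the induction over the \<open>\<sigma>\<close>-algebra
  carries both properties: complements exchange them, and a countable union needs
  \<open>analytic_UN\<close> for the one and \<open>analytic_INT\<close> for the other.
\<close>

lemma borel_imp_analytic_and_coanalytic:
  assumes "A \<in> sets (borel :: (nat \<Rightarrow> bool) measure)"
  shows "analytic A \<and> analytic (- A)"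
proof -
  have "sets (borel :: (nat \<Rightarrow> bool) measure)
      = sigma_sets UNIV {{x. x i \<in> B} |i B. B \<in> sets (borel :: bool measure)}"
    using sets_PiM_equal_borel[where 'a = nat and 'b = bool]
      sets_PiM_single[of UNIV "\<lambda>_ :: nat. borel :: bool measure"] by simp
  then have "A \<in> sigma_sets UNIV {{x. x i \<in> B} |i B. B \<in> sets (borel :: bool measure)}"
    using assms by simp
  then show ?thesis
  proof (induction rule: sigma_sets.induct)
    case (Basic a)
    then obtain i B where a: "a = {x. x i \<in> B}" by auto
    have "closed {x :: nat \<Rightarrow> bool. x i \<in> B}" for B
      using closed_vimage[OF _ continuous_on_product_coordinates[of i], of B]
      by (simp add: vimage_def closed_def open_discrete)
    from this[of B] this[of "- B"] show ?case
      by (simp add: a analytic_closed Collect_neg_eq)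
  next
    case Empty
    then show ?case by (simp add: analytic_closed)
  next
    case (Compl a)
    then show ?case by (simp add: Compl_eq_Diff_UNIV[symmetric])
  next
    case (Union a)
    then show ?case by (simp add: analytic_UN analytic_INT)
  qed
qed

text \<open>
  The form in which closedness is used: if \<open>q n\<close> agrees with a fixed pair of sequences in the first
  \<open>n\<close> entries, then it converges to that pair in the product topology.
\<close>

lemma closed_contains_coordinatewise_limit:
  fixes K :: "((nat \<Rightarrow> bool) \<times> (nat \<Rightarrow> nat)) set"
  assumes "closed K" and "\<And>n. q n \<in> K"
    and eq: "\<And>i n. i < n \<Longrightarrow> (fst (q n) i, snd (q n) i) = c i"
  shows "(\<lambda>i. fst (c i), \<lambda>i. snd (c i)) \<in> K"
proof -
  have lim: "f \<longlonglongrightarrow> l" if "\<And>i n. i < n \<Longrightarrow> f n i = l i"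
    for f :: "nat \<Rightarrow> nat \<Rightarrow> 'b :: topological_space" and l
  proof -
    have "(\<lambda>n. f n i) \<longlonglongrightarrow> l i" for i
    proof (rule tendsto_eventually)
      show "\<forall>\<^sub>F n in sequentially. f n i = l i"
        using eventually_gt_at_top[of i] by eventually_elim (rule that)
    qed
    then have "limitin (product_topology (\<lambda>i. euclidean) UNIV) f l sequentially"
      unfolding limitin_componentwise by simp
    then show ?thesis
      by (simp add: euclidean_product_topology)
  qed
  have "(\<lambda>n. fst (q n)) \<longlonglongrightarrow> (\<lambda>i. fst (c i))" "(\<lambda>n. snd (q n)) \<longlonglongrightarrow> (\<lambda>i. snd (c i))"
    by (rule lim, metis eq fst_conv snd_conv)+
  from tendsto_Pair[OF this] have "q \<longlonglongrightarrow> (\<lambda>i. fst (c i), \<lambda>i. snd (c i))"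
    by simp
  then show ?thesis
    using assms(1,2) closed_sequentially by blast
qed

section \<open>Separation by monotone circuits\<close>

text \<open>
  Only the first components, the points, are separated. The witnesses are kept because the
  separation argument cuts \<open>K\<close> and \<open>L\<close> along them.
\<close>

definition circuit_separable :: "((nat \<Rightarrow> bool) \<times> 'a) set \<Rightarrow> ((nat \<Rightarrow> bool) \<times> 'b) set \<Rightarrow> bool" where
  "circuit_separable K L \<longleftrightarrow> (\<exists>f. monotone_computable f \<and> (\<forall>p\<in>K. f (fst p)) \<and> (\<forall>p\<in>L. \<not> f (fst p)))"

text \<open>
  If \<open>f c d\<close> separates the fibre of \<open>c\<close> from that of \<open>d\<close>, then \<open>\<exists>c. \<forall>d. f c d x\<close> separates the
  unions of the fibres. The indices are enumerated by natural numbers to fit countable gates.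
\<close>

lemma circuit_separable_fibres:
  fixes g :: "_ \<Rightarrow> 'c :: countable" and h :: "_ \<Rightarrow> 'd :: countable"
  assumes "\<And>c d. circuit_separable {p \<in> K. g p = c} {p \<in> L. h p = d}"
  shows "circuit_separable K L"
proof -
  have "\<forall>c d. \<exists>f. monotone_computable f \<and> (\<forall>p\<in>K. g p = c \<longrightarrow> f (fst p))
      \<and> (\<forall>p\<in>L. h p = d \<longrightarrow> \<not> f (fst p))"
  proof (intro allI)
    fix c d
    obtain f where "monotone_computable f" "\<forall>p\<in>{p \<in> K. g p = c}. f (fst p)"
      "\<forall>p\<in>{p \<in> L. h p = d}. \<not> f (fst p)"
      using assms[of c d] unfolding circuit_separable_def by (elim exE conjE)
    then show "\<exists>f. monotone_computable f \<and> (\<forall>p\<in>K. g p = c \<longrightarrow> f (fst p))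
      \<and> (\<forall>p\<in>L. h p = d \<longrightarrow> \<not> f (fst p))"
      by (intro exI[of _ f]) auto
  qed
  then obtain f where f: "monotone_computable (f c d)" "\<And>p. p \<in> K \<Longrightarrow> g p = c \<Longrightarrow> f c d (fst p)"
    "\<And>p. p \<in> L \<Longrightarrow> h p = d \<Longrightarrow> \<not> f c d (fst p)" for c d
    by metis
  define F where "F x = (\<exists>n::nat. \<forall>m::nat. f (from_nat n) (from_nat m) x)" for x
  have "monotone_computable F"
    unfolding F_def by (intro monotone_computable_ex monotone_computable_all f)
  moreover have "F (fst p)" if "p \<in> K" for p
    unfolding F_def by (rule exI[of _ "to_nat (g p)"]) (simp add: f(2) that)
  moreover have "\<not> F (fst p)" if "p \<in> L" for p
    unfolding F_def using f(3)[OF that] by (metis from_nat_to_nat)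
  ultimately show ?thesis
    unfolding circuit_separable_def by blast
qed

text \<open>
  The analogue of Lusin's separation theorem. Disjointness of the projections is strengthened to
  the condition that no point of the first lies below a point of the second: this is
  exactly what makes two points distinguishable by an unnegated input.
\<close>

lemma circuit_separable_closed:
  fixes K L :: "((nat \<Rightarrow> bool) \<times> (nat \<Rightarrow> nat)) set"
  assumes "closed K" "closed L"
    and above: "\<And>p q. p \<in> K \<Longrightarrow> q \<in> L \<Longrightarrow> \<not> fst p \<le> fst q"
  shows "circuit_separable K L"
proof (rule ccontr)
  assume ns: "\<not> circuit_separable K L"
  define entry where "entry p n = (fst p n, snd p n)" for p :: "(nat \<Rightarrow> bool) \<times> (nat \<Rightarrow> nat)" and n
  let ?Q = "\<lambda>n S T. \<exists>c d. fst T = {p \<in> fst S. entry p n = c} \<and> snd T = {p \<in> snd S. entry p n = d}"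
  \<comment> \<open>Stage \<open>n\<close> is an inseparable pair of pieces in which the entries below \<open>n\<close> are fixed.\<close>
  have "\<exists>S. \<forall>n. (\<not> circuit_separable (fst (S n)) (snd (S n)) \<and> (n = 0 \<longrightarrow> S n = (K, L))) \<and> ?Q n (S n) (S (Suc n))"
  proof (rule dependent_nat_choice)
    show "\<exists>S. \<not> circuit_separable (fst S) (snd S) \<and> (0 = 0 \<longrightarrow> S = (K, L))"
      using ns by auto
  next
    fix S :: "((nat \<Rightarrow> bool) \<times> (nat \<Rightarrow> nat)) set \<times> ((nat \<Rightarrow> bool) \<times> (nat \<Rightarrow> nat)) set" and n :: nat
    assume "\<not> circuit_separable (fst S) (snd S) \<and> (n = 0 \<longrightarrow> S = (K, L))"
    then obtain c d where "\<not> circuit_separable {p \<in> fst S. entry p n = c} {p \<in> snd S. entry p n = d}"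
      using circuit_separable_fibres[of "fst S" "\<lambda>p. entry p n" "snd S" "\<lambda>p. entry p n"] by blast
    then show "\<exists>T. (\<not> circuit_separable (fst T) (snd T) \<and> (Suc n = 0 \<longrightarrow> T = (K, L))) \<and> ?Q n S T"
      by (intro exI[of _ "({p \<in> fst S. entry p n = c}, {p \<in> snd S. entry p n = d})"]
            conjI exI[of _ c] exI[of _ d]) simp_all
  qed
  then obtain S where S: "\<And>n. \<not> circuit_separable (fst (S n)) (snd (S n))" "S 0 = (K, L)"
    and Q: "\<And>n. ?Q n (S n) (S (Suc n))"
    by blast
  have "\<forall>n. \<exists>c. fst (S (Suc n)) = {p \<in> fst (S n). entry p n = c}"
    using Q by blast
  from choice[OF this] obtain c
    where c: "\<And>n. fst (S (Suc n)) = {p \<in> fst (S n). entry p n = c n}"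
    by blast
  have "\<forall>n. \<exists>d. snd (S (Suc n)) = {p \<in> snd (S n). entry p n = d}"
    using Q by blast
  from choice[OF this] obtain d
    where d: "\<And>n. snd (S (Suc n)) = {p \<in> snd (S n). entry p n = d n}"
    by blast
  have Kn: "p \<in> K \<and> (\<forall>i<n. entry p i = c i)" if "p \<in> fst (S n)" for p n
    using that by (induction n) (auto simp: S(2) c less_Suc_eq)
  have Ln: "p \<in> L \<and> (\<forall>i<n. entry p i = d i)" if "p \<in> snd (S n)" for p n
    using that by (induction n) (auto simp: S(2) d less_Suc_eq)
  \<comment> \<open>Constant circuits separate the empty set from anything, so no piece is empty.\<close>
  have "\<exists>p. p \<in> fst (S n)" for n
    using S(1)[of n] monotone_computable_const[of False] unfolding circuit_separable_def by blast
  then obtain p where p: "p n \<in> fst (S n)" for n by metis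
  have a: "(\<lambda>i. fst (c i), \<lambda>i. snd (c i)) \<in> K"
    by (rule closed_contains_coordinatewise_limit[OF assms(1), of p]) (use Kn[OF p] in \<open>auto simp: entry_def\<close>)
  have "\<exists>q. q \<in> snd (S n)" for n
    using S(1)[of n] monotone_computable_const[of True] unfolding circuit_separable_def by blast
  then obtain q where q: "q n \<in> snd (S n)" for n by metis
  have b: "(\<lambda>i. fst (d i), \<lambda>i. snd (d i)) \<in> L"
    by (rule closed_contains_coordinatewise_limit[OF assms(2), of q]) (use Ln[OF q] in \<open>auto simp: entry_def\<close>)
  obtain i where i: "fst (c i)" "\<not> fst (d i)"
    using above[OF a b] by (auto simp: le_fun_def)
  \<comment> \<open>Entry \<open>i\<close> is fixed from stage \<open>Suc i\<close> on.\<close>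
  have "circuit_separable (fst (S (Suc i))) (snd (S (Suc i)))"
    unfolding circuit_separable_def
  proof (intro exI conjI ballI)
    show "monotone_computable (\<lambda>x. x i)" by (rule monotone_computable_coordinate)
    show "fst p i" if "p \<in> fst (S (Suc i))" for p
      using Kn[OF that] i by (metis entry_def fst_conv lessI)
    show "\<not> fst p i" if "p \<in> snd (S (Suc i))" for p
      using Ln[OF that] i by (metis entry_def fst_conv lessI)
  qed
  then show False using S(1) by blast
qed

theorem theorem6p7:
  fixes f :: "(nat \<Rightarrow> bool) \<Rightarrow> bool"
  assumes "borel_function f"
    and "mono f"
  shows "\<exists>C. monotone_circuit C \<and> computes C f"
proof -
  have "analytic (f -` {True})" "analytic (- (f -` {True}))"
    using borel_imp_analytic_and_coanalytic assms(1) by (auto simp: borel_function_def)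
  then obtain K L :: "((nat \<Rightarrow> bool) \<times> (nat \<Rightarrow> nat)) set"
    where K: "closed K" "f -` {True} = fst ` K" and L: "closed L" "- (f -` {True}) = fst ` L"
    unfolding analytic_def by auto
  have fK: "f (fst p)" if "p \<in> K" for p
    using K(2) that by blast
  have fL: "\<not> f (fst p)" if "p \<in> L" for p
    using L(2) that by blast
  have "\<not> fst p \<le> fst q" if "p \<in> K" "q \<in> L" for p q
    using fK[OF that(1)] fL[OF that(2)] monoD[OF assms(2), of "fst p" "fst q"] by auto
  from circuit_separable_closed[OF K(1) L(1) this]
  obtain g where g: "monotone_computable g" "\<And>p. p \<in> K \<Longrightarrow> g (fst p)" "\<And>p. p \<in> L \<Longrightarrow> \<not> g (fst p)"
    unfolding circuit_separable_def by blast
  have "g x = f x" for x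
  proof (cases "f x")
    case True
    then have "x \<in> fst ` K" using K(2) by blast
    then show ?thesis using True g(2) by auto
  next
    case False
    then have "x \<in> fst ` L" using L(2) by blast
    then show ?thesis using False g(3) by auto
  qed
  then have "g = f" by blast
  then show ?thesis
    using g(1) by (simp add: monotone_computable_def)
qed

end
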